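(* For fixed $m,n,k$, let each of the names strong $\mathbb{EHP}$, $\mathbb{EHP}$, $\mathbb{EHE}$, $\mathbb{EHR}_0$, $\mathbb{EHND}$, strong $\mathbb{EHND}$ also denote the set of all tuples $\widehat{\mathcal{A}}=(\mathcal{A}_0,\dots,\mathcal{A}_k)\in\mathbb{T}(m,n)^{k+1}$ having that property. Then: (i) for every $k\ge 1$, strong $\mathbb{EHP}\subseteq\mathbb{EHP}\subseteq\mathbb{EHE}\subseteq\mathbb{EHR}_0$; (ii) $\mathbb{EHND}\subseteq\mathbb{EHR}_0$ when $0\le k\le 1$; this inclusion need not hold in general (it can fail for $k=2$, i.e. for some $m,n$ there is an $\mathbb{EHND}$ tensor with $k=2$ that is not an $\mathbb{EHR}_0$ tensor); (iii) for every $k\ge 1$, $\mathbb{EHP}\subseteq\mathbb{EHND}$ and strong $\mathbb{EHP}\subseteq$ strong $\mathbb{EHND}\subseteq\mathbb{EHND}$; (iv) strong $\mathbb{EHND}\subseteq\mathbb{EHR}_0$ when $0\le k\le 1$; this inclusion need not hold in general (it can fail for $k=2$, i.e. for some $m,n$ there is a strong $\mathbb{EHND}$ tensor with $k=2$ that is not an $\mathbb{EHR}_0$ tensor).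
   Context: Let $m\ge 2$, $n\ge 1$ be integers. $\mathbb{T}(m,n)$ is the set of real tensors $\mathcal{A}=(a_{i_1\dots i_m})$ of order $m$ and dimension $n$ ($i_1,\dots,i_m\in\{1,\dots,n\}$; no symmetry assumed). For $x\in\mathbb{R}^n$, $\mathcal{A}x^{m-1}\in\mathbb{R}^n$ is defined by $(\mathcal{A}x^{m-1})_i=\sum_{i_2,\dots,i_m=1}^n a_{ii_2\dots i_m}x_{i_2}\cdots x_{i_m}$. $x\wedge y$ is the componentwise minimum, $x\ast y$ the componentwise product, and vector inequalities are componentwise. Write $[k]=\{1,\dots,k\}$. For $\widehat{\mathcal{A}}=(\mathcal{A}_0,\dots,\mathcal{A}_k)\in\mathbb{T}(m,n)^{k+1}$ let (E) be the equation $\mathcal{A}_0x_0^{m-1}=\sum_{j=1}^k\mathcal{A}_jx_j^{m-1}$ in $(x_0,\dots,x_k)\in(\mathbb{R}^n)^{k+1}$, and let (D) be the equation $\mathcal{A}_0x_0^{m-1}-\mathcal{A}_0\bar x_0^{m-1}=\sum_{j=1}^k(\mathcal{A}_jx_j^{m-1}-\mathcal{A}_j\bar x_j^{m-1})$ in $x_i,\bar x_i\in\mathbb{R}^n$, $0\le i\le k$. (For $k=0$ the sums are zero and the conditions indexed by an empty set are void.) Then $\widehat{\mathcal{A}}$ is: - an $\mathbb{EHR}_0$ tensor if (E) and $x_0\wedge x_i=0$ for all $i\in[k]$ imply $x_i=0$ for all $0\le i\le k$; - an $\mathbb{EHP}$ tensor if (E) and $x_0\ast x_i\le 0$ for all $i\in[k]$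 imply $x_i=0$ for all $0\le i\le k$; - a strong $\mathbb{EHP}$ tensor if (D) and $(x_0-\bar x_0)\ast(x_i-\bar x_i)\le 0$ for all $i\in[k]$ imply $x_i=\bar x_i$ for all $0\le i\le k$; - an $\mathbb{EHE}$ tensor if (E), $x_i\ge 0$ for all $i\in[k]$, and $x_0\ast x_i\le 0$ for all $i\in[k]$ imply $x_i=0$ for all $0\le i\le k$; - an $\mathbb{EHND}$ tensor if (E) and $x_i\ast x_j=0$ for all $0\le i<j\le k$ imply $x_i=0$ for all $0\le i\le k$; - a strong $\mathbb{EHND}$ tensor if (D) and $(x_i-\bar x_i)\ast(x_j-\bar x_j)=0$ for all $0\le i<j\le k$ imply $x_i=\bar x_i$ for all $0\le i\le k$. *)

theory Defs
  imports "Jordan_Normal_Form.Matrix"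
begin

(* The vectors of R^n are the elements of carrier_vec n; (<=) on vectors is componentwise
   (less_eq_vec_def). Coordinates are numbered 0, ..., n - 1 instead of 1, ..., n. *)

definition vec_min :: "real vec \<Rightarrow> real vec \<Rightarrow> real vec" (infixl "\<and>\<^sub>v" 70) where
  "x \<and>\<^sub>v y = vec (dim_vec x) (\<lambda>i. min (x $ i) (y $ i))"

definition vec_mult :: "real vec \<Rightarrow> real vec \<Rightarrow> real vec" (infixl "\<star>\<^sub>v" 70) where
  "x \<star>\<^sub>v y = vec (dim_vec x) (\<lambda>i. x $ i * y $ i)"

definition multi_indices :: "nat \<Rightarrow> nat \<Rightarrow> nat list set" where
  "multi_indices m n = {is. set is \<subseteq> {..<n} \<and> length is = m}"

type_synonym tensor = "nat list \<Rightarrow> real"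

(* A tensor maps the index list [i_1, ..., i_m] to the entry a_{i_1 ... i_m}. The extensional
   function space fixes the value elsewhere, so equal entries mean equal tensors. *)
definition tensors :: "nat \<Rightarrow> nat \<Rightarrow> tensor set" where
  "tensors m n = multi_indices m n \<rightarrow>\<^sub>E UNIV"

(* The vector A x^(m-1); the list js is (i_2, ..., i_m). *)
definition tensor_app :: "nat \<Rightarrow> nat \<Rightarrow> tensor \<Rightarrow> real vec \<Rightarrow> real vec" where
  "tensor_app m n A x =
     vec n (\<lambda>i. \<Sum>js\<in>multi_indices (m - 1) n. A (i # js) * (\<Prod>j\<leftarrow>js. x $ j))"

definition tensor_tuples :: "nat \<Rightarrow> nat \<Rightarrow> nat \<Rightarrow> (nat \<Rightarrow> tensor) set" where
  "tensor_tuples m n k = {0..k} \<rightarrow>\<^sub>E tensors m n"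

definition vec_tuples :: "nat \<Rightarrow> nat \<Rightarrow> (nat \<Rightarrow> real vec) set" where
  "vec_tuples n k = {0..k} \<rightarrow>\<^sub>E carrier_vec n"

definition eq_E :: "nat \<Rightarrow> nat \<Rightarrow> nat \<Rightarrow> (nat \<Rightarrow> tensor) \<Rightarrow> (nat \<Rightarrow> real vec) \<Rightarrow> bool" where
  "eq_E m n k A x \<longleftrightarrow>
     tensor_app m n (A 0) (x 0) =
     finsum_vec TYPE(real) n (\<lambda>j. tensor_app m n (A j) (x j)) {1..k}"

definition eq_D ::
  "nat \<Rightarrow> nat \<Rightarrow> nat \<Rightarrow> (nat \<Rightarrow> tensor) \<Rightarrow> (nat \<Rightarrow> real vec) \<Rightarrow> (nat \<Rightarrow> real vec) \<Rightarrow> bool" where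
  "eq_D m n k A x y \<longleftrightarrow>
     tensor_app m n (A 0) (x 0) - tensor_app m n (A 0) (y 0) =
     finsum_vec TYPE(real) n
       (\<lambda>j. tensor_app m n (A j) (x j) - tensor_app m n (A j) (y j)) {1..k}"

definition EHR0 :: "nat \<Rightarrow> nat \<Rightarrow> nat \<Rightarrow> (nat \<Rightarrow> tensor) set" where
  "EHR0 m n k = {A \<in> tensor_tuples m n k. \<forall>x \<in> vec_tuples n k.
     eq_E m n k A x \<and> (\<forall>i\<in>{1..k}. x 0 \<and>\<^sub>v x i = 0\<^sub>v n)
     \<longrightarrow> (\<forall>i\<in>{0..k}. x i = 0\<^sub>v n)}"

definition EHP :: "nat \<Rightarrow> nat \<Rightarrow> nat \<Rightarrow> (nat \<Rightarrow> tensor) set" where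
  "EHP m n k = {A \<in> tensor_tuples m n k. \<forall>x \<in> vec_tuples n k.
     eq_E m n k A x \<and> (\<forall>i\<in>{1..k}. x 0 \<star>\<^sub>v x i \<le> 0\<^sub>v n)
     \<longrightarrow> (\<forall>i\<in>{0..k}. x i = 0\<^sub>v n)}"

definition strong_EHP :: "nat \<Rightarrow> nat \<Rightarrow> nat \<Rightarrow> (nat \<Rightarrow> tensor) set" where
  "strong_EHP m n k = {A \<in> tensor_tuples m n k. \<forall>x \<in> vec_tuples n k. \<forall>y \<in> vec_tuples n k.
     eq_D m n k A x y \<and> (\<forall>i\<in>{1..k}. (x 0 - y 0) \<star>\<^sub>v (x i - y i) \<le> 0\<^sub>v n)
     \<longrightarrow> (\<forall>i\<in>{0..k}. x i = y i)}"

definition EHE :: "nat \<Rightarrow> nat \<Rightarrow> nat \<Rightarrow> (nat \<Rightarrow> tensor) set" where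
  "EHE m n k = {A \<in> tensor_tuples m n k. \<forall>x \<in> vec_tuples n k.
     eq_E m n k A x \<and> (\<forall>i\<in>{1..k}. 0\<^sub>v n \<le> x i) \<and> (\<forall>i\<in>{1..k}. x 0 \<star>\<^sub>v x i \<le> 0\<^sub>v n)
     \<longrightarrow> (\<forall>i\<in>{0..k}. x i = 0\<^sub>v n)}"

definition EHND :: "nat \<Rightarrow> nat \<Rightarrow> nat \<Rightarrow> (nat \<Rightarrow> tensor) set" where
  "EHND m n k = {A \<in> tensor_tuples m n k. \<forall>x \<in> vec_tuples n k.
     eq_E m n k A x \<and> (\<forall>i j. i < j \<and> j \<le> k \<longrightarrow> x i \<star>\<^sub>v x j = 0\<^sub>v n)
     \<longrightarrow> (\<forall>i\<in>{0..k}. x i = 0\<^sub>v n)}"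

definition strong_EHND :: "nat \<Rightarrow> nat \<Rightarrow> nat \<Rightarrow> (nat \<Rightarrow> tensor) set" where
  "strong_EHND m n k = {A \<in> tensor_tuples m n k. \<forall>x \<in> vec_tuples n k. \<forall>y \<in> vec_tuples n k.
     eq_D m n k A x y \<and> (\<forall>i j. i < j \<and> j \<le> k \<longrightarrow> (x i - y i) \<star>\<^sub>v (x j - y j) = 0\<^sub>v n)
     \<longrightarrow> (\<forall>i\<in>{0..k}. x i = y i)}"

end

theory Submission
  imports Defs
begin

text \<open>
  A strong property specialises to the plain one by comparing a solution with the zero tuple:
  for \<open>m \<ge> 2\<close> the form \<open>A x\<^sup>m\<^sup>-\<^sup>1\<close> vanishes at \<open>x = 0\<close>, so equation (D) against the zero tuple is
  equation (E). Every other inclusion, apart from compositions such as strong EHND in EHR0, keeps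
  the equation and only compares complementarity conditions: that of the smaller class is a
  consequence of that of the larger one. Coordinatewise, \<open>min a b = 0\<close> forces \<open>b \<ge> 0\<close> and
  \<open>a b = 0\<close>, and \<open>a b = 0\<close> forces \<open>a b \<le> 0\<close>.

  From \<open>k = 2\<close> on, the EHND condition also demands that \<open>x\<^sub>1\<close> and \<open>x\<^sub>2\<close> have disjoint supports,
  which the EHR0 condition does not; the strong EHND condition demands it of the differences. In
  dimension one disjoint supports leave at most one nonzero \<open>x\<^sub>i\<close>, or at most one nonzero
  difference, so for \<open>m = 2\<close> a triple of scalars is strong EHND as soon as all three are
  nonzero. The scalars \<open>1, 1, -1\<close> are such a triple, but
  \<open>1 \<cdot> 0 = 1 \<cdot> 1 + (-1) \<cdot> 1\<close> shows that they are not EHR0.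
\<close>

section \<open>The equations in coordinates\<close>

lemma tensor_app_carrier [simp]: "tensor_app m n A x \<in> carrier_vec n"
  by (simp add: tensor_app_def)

lemma eq_E_iff_coordinates:
  "eq_E m n k A x \<longleftrightarrow>
     (\<forall>i<n. tensor_app m n (A 0) (x 0) $ i = (\<Sum>j=1..k. tensor_app m n (A j) (x j) $ i))"
proof -
  let ?s = "finsum_vec TYPE(real) n (\<lambda>j. tensor_app m n (A j) (x j)) {1..k}"
  have "?s \<in> carrier_vec n"
    by (rule finsum_vec_closed) simp
  moreover have "?s $ i = (\<Sum>j=1..k. tensor_app m n (A j) (x j) $ i)" if "i < n" for i
    using that by (intro index_finsum_vec) auto
  ultimately show ?thesis
    unfolding eq_E_def vec_eq_iff by (simp add: carrier_vecD[OF tensor_app_carrier])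
qed

lemma eq_D_iff_coordinates:
  "eq_D m n k A x y \<longleftrightarrow>
     (\<forall>i<n. tensor_app m n (A 0) (x 0) $ i - tensor_app m n (A 0) (y 0) $ i =
        (\<Sum>j=1..k. tensor_app m n (A j) (x j) $ i - tensor_app m n (A j) (y j) $ i))"
proof -
  let ?d = "\<lambda>j. tensor_app m n (A j) (x j) - tensor_app m n (A j) (y j)"
  let ?s = "finsum_vec TYPE(real) n ?d {1..k}"
  have "?s \<in> carrier_vec n"
    by (rule finsum_vec_closed) simp
  moreover have "?s $ i = (\<Sum>j=1..k. ?d j $ i)" if "i < n" for i
    using that by (intro index_finsum_vec) auto
  ultimately show ?thesis
    unfolding eq_D_def vec_eq_iff by (simp add: carrier_vecD[OF tensor_app_carrier])
qed

section \<open>Comparison with the zero tuple\<close>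

text \<open>The hypothesis \<open>m \<ge> 2\<close> matters: for \<open>m = 1\<close> the form is constant, as every product is empty.\<close>

lemma tensor_app_zero:
  assumes "m \<ge> 2"
  shows "tensor_app m n A (0\<^sub>v n) = 0\<^sub>v n"
proof -
  have "(\<Prod>j\<leftarrow>js. 0\<^sub>v n $ j) = (0::real)" if "js \<in> multi_indices (m - 1) n" for js
    using that assms by (cases js) (auto simp: multi_indices_def)
  then show ?thesis
    by (auto simp: tensor_app_def intro!: eq_vecI sum.neutral)
qed

definition zero_tuple :: "nat \<Rightarrow> nat \<Rightarrow> nat \<Rightarrow> real vec" where
  "zero_tuple n k = (\<lambda>i\<in>{0..k}. 0\<^sub>v n)"

lemma zero_tuple_in_vec_tuples [simp]: "zero_tuple n k \<in> vec_tuples n k"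
  by (simp add: zero_tuple_def vec_tuples_def)

lemma zero_tuple_apply [simp]: "i \<le> k \<Longrightarrow> zero_tuple n k i = 0\<^sub>v n"
  by (simp add: zero_tuple_def)

lemma vec_tuples_carrier: "x \<in> vec_tuples n k \<Longrightarrow> i \<le> k \<Longrightarrow> x i \<in> carrier_vec n"
  by (auto simp: vec_tuples_def)

lemma vec_tuples_minus_zero_tuple:
  "x \<in> vec_tuples n k \<Longrightarrow> i \<le> k \<Longrightarrow> x i - zero_tuple n k i = x i"
  using vec_tuples_carrier[of x n k i] by auto

lemma eq_D_zero_tuple:
  assumes "m \<ge> 2"
  shows "eq_D m n k A x (zero_tuple n k) \<longleftrightarrow> eq_E m n k A x"
  unfolding eq_D_iff_coordinates eq_E_iff_coordinates
  using assms by (simp add: tensor_app_zero)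

lemma strong_EHP_subset_EHP:
  assumes "m \<ge> 2"
  shows "strong_EHP m n k \<subseteq> EHP m n k"
proof
  fix A assume A: "A \<in> strong_EHP m n k"
  have "\<forall>i\<in>{0..k}. x i = 0\<^sub>v n"
    if x: "x \<in> vec_tuples n k" and E: "eq_E m n k A x"
      and c: "\<forall>i\<in>{1..k}. x 0 \<star>\<^sub>v x i \<le> 0\<^sub>v n" for x
  proof -
    let ?z = "zero_tuple n k"
    have "eq_D m n k A x ?z"
      using E eq_D_zero_tuple[OF assms] by blast
    moreover have "\<forall>i\<in>{1..k}. (x 0 - ?z 0) \<star>\<^sub>v (x i - ?z i) \<le> 0\<^sub>v n"
      using c vec_tuples_minus_zero_tuple[OF x] by simp
    ultimately have "\<forall>i\<in>{0..k}. x i = ?z i"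
      using A x zero_tuple_in_vec_tuples unfolding strong_EHP_def by blast
    then show ?thesis by simp
  qed
  then show "A \<in> EHP m n k"
    using A by (auto simp: EHP_def strong_EHP_def)
qed

lemma strong_EHND_subset_EHND:
  assumes "m \<ge> 2"
  shows "strong_EHND m n k \<subseteq> EHND m n k"
proof
  fix A assume A: "A \<in> strong_EHND m n k"
  have "\<forall>i\<in>{0..k}. x i = 0\<^sub>v n"
    if x: "x \<in> vec_tuples n k" and E: "eq_E m n k A x"
      and c: "\<forall>i j. i < j \<and> j \<le> k \<longrightarrow> x i \<star>\<^sub>v x j = 0\<^sub>v n" for x
  proof -
    let ?z = "zero_tuple n k"
    have "eq_D m n k A x ?z"
      using E eq_D_zero_tuple[OF assms] by blast
    moreover have "\<forall>i j. i < j \<and> j \<le> k \<longrightarrow> (x i - ?z i) \<star>\<^sub>v (x j - ?z j) = 0\<^sub>v n"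
      using c vec_tuples_minus_zero_tuple[OF x] by simp
    ultimately have "\<forall>i\<in>{0..k}. x i = ?z i"
      using A x zero_tuple_in_vec_tuples unfolding strong_EHND_def by blast
    then show ?thesis by simp
  qed
  then show "A \<in> EHND m n k"
    using A by (auto simp: EHND_def strong_EHND_def)
qed

section \<open>Inclusions from comparing complementarity conditions\<close>

lemma vec_min_eq_zeroD:
  assumes "x \<in> carrier_vec n" "y \<in> carrier_vec n" "x \<and>\<^sub>v y = 0\<^sub>v n"
  shows "0\<^sub>v n \<le> y" "x \<star>\<^sub>v y = 0\<^sub>v n"
proof -
  have *: "min (x $ i) (y $ i) = 0" if "i < n" for i
    using arg_cong[OF assms(3), of "\<lambda>v. v $ i"] that assms(1) by (simp add: vec_min_def)
  show "0\<^sub>v n \<le> y"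
    using assms(2) * by (fastforce simp: less_eq_vec_def min_def split: if_splits)
  show "x \<star>\<^sub>v y = 0\<^sub>v n"
    using assms(1) * by (fastforce simp: vec_mult_def min_def split: if_splits intro!: eq_vecI)
qed

lemma EHP_subset_EHE: "EHP m n k \<subseteq> EHE m n k"
  unfolding EHP_def EHE_def by blast

lemma EHE_subset_EHR0: "EHE m n k \<subseteq> EHR0 m n k"
proof
  fix A assume A: "A \<in> EHE m n k"
  have "\<forall>i\<in>{0..k}. x i = 0\<^sub>v n"
    if x: "x \<in> vec_tuples n k" and E: "eq_E m n k A x"
      and c: "\<forall>i\<in>{1..k}. x 0 \<and>\<^sub>v x i = 0\<^sub>v n" for x
  proof -
    have "0\<^sub>v n \<le> x i \<and> x 0 \<star>\<^sub>v x i \<le> 0\<^sub>v n" if "i \<in> {1..k}" for i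
      using vec_min_eq_zeroD[of "x 0" n "x i"] vec_tuples_carrier[OF x] c that by simp
    then show ?thesis
      using A x E unfolding EHE_def by blast
  qed
  then show "A \<in> EHR0 m n k"
    using A by (auto simp: EHR0_def EHE_def)
qed

text \<open>For \<open>k \<le> 1\<close> the only possible pair of indices \<open>i < j \<le> k\<close> is \<open>(0, 1)\<close>, and for that pair the
  EHR0 condition does control the product.\<close>

lemma EHND_subset_EHR0:
  assumes "k \<le> 1"
  shows "EHND m n k \<subseteq> EHR0 m n k"
proof
  fix A assume A: "A \<in> EHND m n k"
  have "\<forall>i\<in>{0..k}. x i = 0\<^sub>v n"
    if x: "x \<in> vec_tuples n k" and E: "eq_E m n k A x"
      and c: "\<forall>i\<in>{1..k}. x 0 \<and>\<^sub>v x i = 0\<^sub>v n" for x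
  proof -
    have "x i \<star>\<^sub>v x j = 0\<^sub>v n" if "i < j" "j \<le> k" for i j
    proof -
      have "i = 0" using that assms by simp
      then show ?thesis
        using vec_min_eq_zeroD(2)[of "x 0" n "x j"] vec_tuples_carrier[OF x] c that by simp
    qed
    then show ?thesis
      using A x E unfolding EHND_def by blast
  qed
  then show "A \<in> EHR0 m n k"
    using A by (auto simp: EHR0_def EHND_def)
qed

lemma EHP_subset_EHND: "EHP m n k \<subseteq> EHND m n k"
proof
  fix A assume A: "A \<in> EHP m n k"
  have "\<forall>i\<in>{0..k}. x i = 0\<^sub>v n"
    if x: "x \<in> vec_tuples n k" and E: "eq_E m n k A x"
      and c: "\<forall>i j. i < j \<and> j \<le> k \<longrightarrow> x i \<star>\<^sub>v x j = 0\<^sub>v n" for x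
  proof -
    have "\<forall>i\<in>{1..k}. x 0 \<star>\<^sub>v x i \<le> 0\<^sub>v n"
      using c by auto
    then show ?thesis
      using A x E unfolding EHP_def by blast
  qed
  then show "A \<in> EHND m n k"
    using A by (auto simp: EHND_def EHP_def)
qed

lemma strong_EHP_subset_strong_EHND: "strong_EHP m n k \<subseteq> strong_EHND m n k"
proof
  fix A assume A: "A \<in> strong_EHP m n k"
  have "\<forall>i\<in>{0..k}. x i = y i"
    if xy: "x \<in> vec_tuples n k" "y \<in> vec_tuples n k" and D: "eq_D m n k A x y"
      and c: "\<forall>i j. i < j \<and> j \<le> k \<longrightarrow> (x i - y i) \<star>\<^sub>v (x j - y j) = 0\<^sub>v n" for x y
  proof -
    have "\<forall>i\<in>{1..k}. (x 0 - y 0) \<star>\<^sub>v (x i - y i) \<le> 0\<^sub>v n"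
      using c by auto
    then show ?thesis
      using A xy D unfolding strong_EHP_def by blast
  qed
  then show "A \<in> strong_EHND m n k"
    using A by (auto simp: strong_EHND_def strong_EHP_def)
qed

section \<open>A strong EHND tensor with \<open>k = 2\<close> that is not EHR0\<close>

definition scalar_tensor :: "real \<Rightarrow> tensor" where
  "scalar_tensor c = (\<lambda>is\<in>multi_indices 2 1. c)"

lemma multi_indices_1_1: "multi_indices (Suc 0) (Suc 0) = {[0]}"
  by (auto simp: multi_indices_def length_Suc_conv)

lemma tensor_app_scalar_tensor:
  "tensor_app 2 1 (scalar_tensor c) x $ 0 = c * x $ 0"
proof -
  have "[0, 0] \<in> multi_indices 2 1"
    by (simp add: multi_indices_def)
  then show ?thesis
    by (simp add: tensor_app_def scalar_tensor_def multi_indices_1_1)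
qed

definition opposite_signs_triple :: "nat \<Rightarrow> tensor" where
  "opposite_signs_triple = (\<lambda>j\<in>{0..2}. scalar_tensor (if j = 2 then -1 else 1))"

lemma opposite_signs_triple_in_tensor_tuples: "opposite_signs_triple \<in> tensor_tuples 2 1 2"
  by (auto simp: opposite_signs_triple_def tensor_tuples_def tensors_def scalar_tensor_def)

lemma opposite_signs_triple_strong_EHND: "opposite_signs_triple \<in> strong_EHND 2 1 2"
proof -
  have "\<forall>i\<in>{0..2}. x i = y i"
    if x: "x \<in> vec_tuples 1 2" and y: "y \<in> vec_tuples 1 2"
      and D: "eq_D 2 1 2 opposite_signs_triple x y"
      and c: "\<forall>i j. i < j \<and> j \<le> 2 \<longrightarrow> (x i - y i) \<star>\<^sub>v (x j - y j) = 0\<^sub>v 1" for x y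
  proof -
    define d where "d i = x i $ 0 - y i $ 0" for i
    have "{1..2} = {1, 2::nat}" by auto
    then have eq: "d 0 = d 1 - d 2"
      using D unfolding eq_D_iff_coordinates
      by (simp add: opposite_signs_triple_def tensor_app_scalar_tensor[simplified] d_def)
    have disjoint: "d i * d j = 0" if "i < j" "j \<le> 2" for i j
    proof -
      have "((x i - y i) \<star>\<^sub>v (x j - y j)) $ 0 = 0" using c that by simp
      then show ?thesis
        using vec_tuples_carrier[OF x, of i] vec_tuples_carrier[OF x, of j]
          vec_tuples_carrier[OF y, of i] vec_tuples_carrier[OF y, of j] that
        by (simp add: vec_mult_def d_def)
    qed
    have "d 0 = 0 \<and> d 1 = 0 \<and> d 2 = 0"
      using eq disjoint[of 0 1] disjoint[of 0 2] disjoint[of 1 2] by auto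
    moreover have "i = 0 \<or> i = 1 \<or> i = 2" if "i \<in> {0..2}" for i :: nat
      using that by auto
    ultimately have zero: "d i = 0" if "i \<in> {0..2}" for i
      using that by blast
    show ?thesis
    proof
      fix i :: nat assume i: "i \<in> {0..2}"
      show "x i = y i"
        using vec_tuples_carrier[OF x, of i] vec_tuples_carrier[OF y, of i] zero[OF i] i
        by (intro eq_vecI) (auto simp: d_def)
    qed
  qed
  then show ?thesis
    using opposite_signs_triple_in_tensor_tuples unfolding strong_EHND_def by blast
qed

lemma opposite_signs_triple_not_EHR0: "opposite_signs_triple \<notin> EHR0 2 1 2"
proof
  assume A: "opposite_signs_triple \<in> EHR0 2 1 2"
  define x :: "nat \<Rightarrow> real vec" where
    "x = (\<lambda>i\<in>{0..2}. if i = 0 then 0\<^sub>v 1 else vec 1 (\<lambda>_. 1))"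
  have x: "x \<in> vec_tuples 1 2"
    by (auto simp: x_def vec_tuples_def)
  have "{1..2} = {1, 2::nat}" by auto
  then have "eq_E 2 1 2 opposite_signs_triple x"
    unfolding eq_E_iff_coordinates
    by (simp add: opposite_signs_triple_def tensor_app_scalar_tensor[simplified] x_def)
  moreover have "\<forall>i\<in>{1..2}. x 0 \<and>\<^sub>v x i = 0\<^sub>v 1"
    by (auto simp: x_def vec_min_def)
  ultimately have "\<forall>i\<in>{0..2}. x i = 0\<^sub>v 1"
    using A x unfolding EHR0_def by blast
  then have "x 1 $ 0 = 0" by simp
  then show False by (simp add: x_def)
qed

theorem proposition3p12:
  shows
    "(\<forall>m\<ge>2. \<forall>n\<ge>1. \<forall>k\<ge>1.
        strong_EHP m n k \<subseteq> EHP m n k \<and> EHP m n k \<subseteq> EHE m n k \<and> EHE m n k \<subseteq> EHR0 m n k)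
   \<and> ((\<forall>m\<ge>2. \<forall>n\<ge>1. \<forall>k\<le>1. EHND m n k \<subseteq> EHR0 m n k)
      \<and> (\<exists>m\<ge>2. \<exists>n\<ge>1. \<exists>A. A \<in> EHND m n 2 \<and> A \<notin> EHR0 m n 2))
   \<and> (\<forall>m\<ge>2. \<forall>n\<ge>1. \<forall>k\<ge>1.
        EHP m n k \<subseteq> EHND m n k
      \<and> strong_EHP m n k \<subseteq> strong_EHND m n k \<and> strong_EHND m n k \<subseteq> EHND m n k)
   \<and> ((\<forall>m\<ge>2. \<forall>n\<ge>1. \<forall>k\<le>1. strong_EHND m n k \<subseteq> EHR0 m n k)
      \<and> (\<exists>m\<ge>2. \<exists>n\<ge>1. \<exists>A. A \<in> strong_EHND m n 2 \<and> A \<notin> EHR0 m n 2))"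
proof (intro conjI allI impI)
  fix m n k :: nat
  assume m: "2 \<le> m"
  show "strong_EHP m n k \<subseteq> EHP m n k" using m by (rule strong_EHP_subset_EHP)
  show "EHP m n k \<subseteq> EHE m n k" by (rule EHP_subset_EHE)
  show "EHE m n k \<subseteq> EHR0 m n k" by (rule EHE_subset_EHR0)
  show "EHP m n k \<subseteq> EHND m n k" by (rule EHP_subset_EHND)
  show "strong_EHP m n k \<subseteq> strong_EHND m n k" by (rule strong_EHP_subset_strong_EHND)
  show "strong_EHND m n k \<subseteq> EHND m n k" using m by (rule strong_EHND_subset_EHND)
next
  fix m n k :: nat
  assume m: "2 \<le> m" and k: "k \<le> 1"
  show "EHND m n k \<subseteq> EHR0 m n k" using k by (rule EHND_subset_EHR0)
  show "strong_EHND m n k \<subseteq> EHR0 m n k"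
    using strong_EHND_subset_EHND[OF m] EHND_subset_EHR0[OF k] by blast
next
  have strong: "\<exists>A. A \<in> strong_EHND 2 1 2 \<and> A \<notin> EHR0 2 1 2"
    using opposite_signs_triple_strong_EHND opposite_signs_triple_not_EHR0 by blast
  then show "\<exists>m\<ge>2. \<exists>n\<ge>1. \<exists>A. A \<in> strong_EHND m n 2 \<and> A \<notin> EHR0 m n 2"
    by (meson order_refl)
  have "\<exists>A. A \<in> EHND 2 1 2 \<and> A \<notin> EHR0 2 1 2"
    using strong strong_EHND_subset_EHND[of 2 1 2] by blast
  then show "\<exists>m\<ge>2. \<exists>n\<ge>1. \<exists>A. A \<in> EHND m n 2 \<and> A \<notin> EHR0 m n 2"
    by (meson order_refl)
qed

end
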